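(* Let $u,v\in\mathbb{N}$ and let $A$ and $B$ be two $u\times v$ matrices with rational entries (finite matrices of the same order), both of which are image partition regular. Then for every finite coloring of $\mathbb{N}$ there exist vectors $\overrightarrow{X},\overrightarrow{Y}\in\mathbb{N}^v$ such that the set $$\{a,\ a+b,\ ab \;:\; a\in A\overrightarrow{X},\ b\in B\overrightarrow{Y}\}$$ is monochromatic, where $a\in A\overrightarrow{X}$ means that $a$ is an entry of the vector $A\overrightarrow{X}$, and $b\in B\overrightarrow{Y}$ means that $b$ is an entry of the vector $B\overrightarrow{Y}$ (so $a$ and $b$ range independently over all entries).
   Context: $\mathbb{N}=\{1,2,3,\dots\}$. A finite coloring of $\mathbb{N}$ is a partition of $\mathbb{N}$ into finitely many disjoint pieces; a set is monochromatic if it is contained in one piece. A finite $u\times v$ matrix $A$ with rational entries is called image partition regular if for every finite coloring of $\mathbb{N}$ there exists $\overrightarrow{X}\in\mathbb{N}^v$ such that all entries of $A\overrightarrow{X}$ lie in one and the same piece of the coloring (in particular, they are all positive integers). *)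

theory Defs
  imports "Jordan_Normal_Form.Matrix" "HOL-Library.Disjoint_Sets"
begin

(* Here the natural numbers of the mathematics start at 1, so they are {1..} :: nat set. *)

definition finite_coloring :: "nat set set \<Rightarrow> bool" where
  "finite_coloring P \<longleftrightarrow> partition_on {1..} P \<and> finite P"

(* S is a set of rationals; since every piece consists of positive integers,
   a monochromatic set does too. *)
definition monochromatic :: "nat set set \<Rightarrow> rat set \<Rightarrow> bool" where
  "monochromatic P S \<longleftrightarrow> (\<exists>C\<in>P. S \<subseteq> of_nat ` C)"

definition pos_vec :: "nat \<Rightarrow> nat vec set" where
  "pos_vec n = {X \<in> carrier_vec n. \<forall>i<n. X $ i \<ge> 1}"

definition image_entries :: "rat mat \<Rightarrow> nat vec \<Rightarrow> rat set" where
  "image_entries A X = vec_set (A *\<^sub>v map_vec of_nat X)"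

definition image_partition_regular :: "rat mat \<Rightarrow> bool" where
  "image_partition_regular A \<longleftrightarrow>
     (\<forall>P. finite_coloring P \<longrightarrow>
        (\<exists>X\<in>pos_vec (dim_col A). monochromatic P (image_entries A X)))"

end

theory Submission
  imports Defs "HOL-Library.Infinite_Set" "HOL-Library.Countable"
begin

text \<open>
  The proof adapts Moreira's argument for monochromatic \<open>{x, x + y, x y}\<close>. Let \<open>f\<close> be the colouring,
  written as a function to colours. By compactness there is a bound \<open>N\<close> such that
  every colouring with the colours of \<open>f\<close> is constant on some image of \<open>A\<close> inside \<open>{..N}\<close>. Replace
  \<open>f\<close> by the refined colouring \<open>g x = (f (m x))\<close>, \<open>m \<le> N\<close>: if \<open>g\<close> has the same value at several
  numbers, then one image of \<open>A\<close> works for all of them at once, so the whole vector of entries \<open>a\<close>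
  can be treated as a single number \<open>x\<close>.

  A descending sequence of piecewise syndetic sets \<open>D k\<close> is built together with numbers \<open>z k\<close>
  such that \<open>g (z k * x)\<close> takes a single value \<open>c k\<close> for all \<open>x \<in> D (Suc k)\<close>. Here \<open>z k = M k * n k * b k\<close>,
  where \<open>M k\<close> is divisible by \<open>fact N\<close> and by the squares of all earlier \<open>z i\<close>, where \<open>n k\<close> is a
  return time, meaning that \<open>x + r * n k\<close> stays in \<open>D k\<close> for all small \<open>r\<close>
  (\<open>piecewise_syndetic_return\<close>, a form of van der Waerden's theorem), and where \<open>b k\<close> is any entry of
  an image \<open>G k\<close> of \<open>B\<close> along which \<open>g (M k * n k * b * x)\<close> does not depend on \<open>b\<close>
  (\<open>piecewise_syndetic_refine\<close>).

  Two of the colours agree, say \<open>c i = c j\<close> with \<open>i < j\<close>. For \<open>x \<in> D (Suc j)\<close> take the numbers \<open>a = z i * x * m\<close>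
  and \<open>b = M j * n j * e / z i\<close>, where \<open>m\<close> runs over a suitable image of \<open>A\<close> in \<open>{..N}\<close> and \<open>e\<close> over
  \<open>G j\<close>. Then \<open>a * b = m * (M j * n j * e * x)\<close> has the colour of \<open>a\<close> because \<open>c i = c j\<close>, and
  \<open>a + b = m * z i * (x + n j * r * e)\<close> with \<open>r = M j / (m * (z i)^2)\<close> has the colour of \<open>a\<close> because
  \<open>x + n j * r * e\<close> returns to \<open>D j\<close> and hence to \<open>D (Suc i)\<close>
  (\<open>partition_regular_sum_product\<close>).
\<close>

section \<open>Piecewise syndetic sets\<close>

text \<open>
  The elements of \<open>D\<close> meet every window of length \<open>h + 1\<close> that starts in some interval, and such
  intervals exist with arbitrary length: this is the usual condition that finitely many shifts of \<open>D\<close>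
  cover a thick set.
\<close>

definition piecewise_syndetic :: "nat set \<Rightarrow> bool" where
  "piecewise_syndetic D \<longleftrightarrow> (\<exists>h. \<forall>L. \<exists>s. \<forall>x\<in>{s..<s+L}. \<exists>i\<le>h. x + i \<in> D)"

lemma piecewise_syndetic_pos: "piecewise_syndetic {1..}"
  unfolding piecewise_syndetic_def
  by (rule exI[of _ 1]) (auto intro!: exI[of _ "1::nat"])

lemma not_piecewise_syndetic_empty: "\<not> piecewise_syndetic {}"
proof
  assume "piecewise_syndetic {}"
  then obtain s where "\<forall>x\<in>{s..<s+(1::nat)}. False"
    unfolding piecewise_syndetic_def by force
  then show False by auto
qed

text \<open>
  If \<open>E\<close> is not piecewise syndetic, every interval of a fixed length \<open>L\<close> contains a window missed by
  \<open>E\<close>. Wherever \<open>D \<union> E\<close> meets all windows, that one must contain a point of \<open>D\<close>, so the gaps of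
  \<open>D\<close> are there bounded by about \<open>L + h\<close>.
\<close>

lemma piecewise_syndetic_Un:
  assumes "piecewise_syndetic (D \<union> E)"
  shows "piecewise_syndetic D \<or> piecewise_syndetic E"
proof (rule disjCI)
  assume nE: "\<not> piecewise_syndetic E"
  obtain h where h: "\<And>L. \<exists>s. \<forall>x\<in>{s..<s+L}. \<exists>i\<le>h. x + i \<in> D \<union> E"
    using assms unfolding piecewise_syndetic_def by blast
  have "\<not> (\<forall>L. \<exists>s. \<forall>x\<in>{s..<s+L}. \<exists>i\<le>h. x + i \<in> E)"
    using nE unfolding piecewise_syndetic_def by metis
  then obtain L where "\<And>s. \<not> (\<forall>x\<in>{s..<s+L}. \<exists>i\<le>h. x + i \<in> E)" by metis
  then have L: "\<exists>x\<in>{s..<s+L}. \<forall>i\<le>h. x + i \<notin> E" for s by simp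
  have "\<exists>s. \<forall>x\<in>{s..<s+K}. \<exists>i\<le>L+h. x + i \<in> D" for K
  proof -
    obtain s where s: "\<forall>x\<in>{s..<s+(K+L)}. \<exists>i\<le>h. x + i \<in> D \<union> E" using h by blast
    have "\<exists>i\<le>L+h. x + i \<in> D" if x: "x \<in> {s..<s+K}" for x
    proof -
      obtain y where y: "y \<in> {x..<x+L}" "\<forall>i\<le>h. y + i \<notin> E" using L by blast
      have "y \<in> {s..<s+(K+L)}" using x y by auto
      then obtain i where i: "i \<le> h" "y + i \<in> D" using s y(2) by blast
      then have "x + (y - x + i) \<in> D" "y - x + i \<le> L + h" using y(1) by auto
      then show ?thesis by blast
    qed
    then show ?thesis by blast
  qed
  then show "piecewise_syndetic D" unfolding piecewise_syndetic_def by blast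
qed

lemma piecewise_syndetic_UN:
  assumes "finite I" "piecewise_syndetic (\<Union>i\<in>I. D i)"
  shows "\<exists>i\<in>I. piecewise_syndetic (D i)"
  using assms
proof (induction I)
  case empty
  then show ?case using not_piecewise_syndetic_empty by simp
next
  case (insert i I)
  then show ?case using piecewise_syndetic_Un[of "D i" "\<Union>i\<in>I. D i"] by auto
qed

lemma piecewise_syndetic_color:
  assumes "piecewise_syndetic D" "finite (f ` D)"
  shows "\<exists>c. piecewise_syndetic {x \<in> D. f x = c}"
proof -
  have "(\<Union>c\<in>f ` D. {x \<in> D. f x = c}) = D" by auto
  then show ?thesis
    using piecewise_syndetic_UN[OF assms(2), of "\<lambda>c. {x \<in> D. f x = c}"] assms(1) by auto
qed

section \<open>Compactness of colourings\<close>

text \<open>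
  The colours are natural numbers, and finiteness of the range replaces a bound on their number;
  this makes refined colourings available through any encoding of the refined colours.
\<close>

definition partition_regular :: "nat set set \<Rightarrow> bool" where
  "partition_regular \<F> \<longleftrightarrow>
     (\<forall>f :: nat \<Rightarrow> nat. finite (range f) \<longrightarrow> (\<exists>F\<in>\<F>. \<exists>c. \<forall>x\<in>F. f x = c))"

text \<open>
  A diagonal argument: shrink an infinite set of indices \<open>k\<close> successively so that \<open>f k m\<close> becomes
  constant on the \<open>m\<close>-th set.
\<close>

lemma pointwise_limit_of_colorings:
  fixes f :: "nat \<Rightarrow> nat \<Rightarrow> nat"
  assumes "finite C" "\<And>k. range (f k) \<subseteq> C"
  obtains g where "range g \<subseteq> C" "\<And>m. \<exists>k\<ge>m. \<forall>x\<le>m. f k x = g x"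
proof -
  have "\<exists>S. \<forall>m. infinite (S m) \<and> (S (Suc m) \<subseteq> S m \<and> (\<exists>c. \<forall>k\<in>S (Suc m). f k m = c))"
  proof (rule dependent_nat_choice)
    show "\<exists>x::nat set. infinite x" using infinite_UNIV_nat by blast
  next
    fix S :: "nat set" and m
    assume S: "infinite S"
    have "finite ((\<lambda>k. f k m) ` S)"
      using assms(2) by (intro finite_subset[OF _ assms(1)]) auto
    then obtain k0 where "infinite {k \<in> S. f k m = f k0 m}"
      using pigeonhole_infinite[OF S, of "\<lambda>k. f k m"] by auto
    then show "\<exists>S'. infinite S' \<and> S' \<subseteq> S \<and> (\<exists>c. \<forall>k\<in>S'. f k m = c)"
      by (intro exI[of _ "{k \<in> S. f k m = f k0 m}"]) auto
  qed
  then obtain S g where S: "\<And>m. infinite (S m)" "\<And>m. S (Suc m) \<subseteq> S m"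
    and g: "\<And>m k. k \<in> S (Suc m) \<Longrightarrow> f k m = g m" by metis
  have anti: "S j \<subseteq> S i" if "i \<le> j" for i j
    using lift_Suc_antimono_le[of S, OF S(2) that] .
  show thesis
  proof
    show "range g \<subseteq> C"
    proof clarify
      fix m
      obtain k where "k \<in> S (Suc m)" using S(1) by (metis finite.emptyI all_not_in_conv)
      then show "g m \<in> C" using g assms(2) by (metis rangeI subsetD)
    qed
    fix m
    have "\<exists>k\<ge>m. k \<in> S (Suc m)"
      using S(1)[of "Suc m"] unfolding infinite_nat_iff_unbounded_le by (rule spec)
    then obtain k where k: "k \<ge> m" "k \<in> S (Suc m)" by blast
    have "f k x = g x" if "x \<le> m" for x
      using subsetD[OF anti[of "Suc x" "Suc m"] k(2)] that g by simp
    with k(1) show "\<exists>k\<ge>m. \<forall>x\<le>m. f k x = g x" by blast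
  qed
qed

text \<open>
  If every bound \<open>N\<close> had a counterexample, a pointwise limit of these would be a colouring of all
  of the natural numbers; a monochromatic finite set for the limit is also one for a
  counterexample with large \<open>N\<close>.
\<close>

lemma partition_regular_bounded:
  assumes "partition_regular \<F>" "\<And>F. F \<in> \<F> \<Longrightarrow> finite F" "finite (C :: nat set)"
  shows "\<exists>N. \<forall>f. range f \<subseteq> C \<longrightarrow> (\<exists>F\<in>\<F>. F \<subseteq> {..N} \<and> (\<exists>c. \<forall>x\<in>F. f x = c))"
proof (rule ccontr)
  assume "\<not> ?thesis"
  then obtain f where f: "\<And>N. range (f N) \<subseteq> C"
    and bad: "\<And>N F c. F \<in> \<F> \<Longrightarrow> F \<subseteq> {..N} \<Longrightarrow> \<not> (\<forall>x\<in>F. f N x = c)"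
    by metis
  obtain g where g: "range g \<subseteq> C" "\<And>m. \<exists>k\<ge>m. \<forall>x\<le>m. f k x = g x"
    by (rule pointwise_limit_of_colorings[OF assms(3), of f]) (use f in auto)
  obtain F c where F: "F \<in> \<F>" "\<forall>x\<in>F. g x = c"
    using assms(1) finite_subset[OF g(1) assms(3)] unfolding partition_regular_def by blast
  obtain m where m: "F \<subseteq> {..m}" using assms(2)[OF F(1)] finite_nat_iff_bounded_le by blast
  obtain k where k: "k \<ge> m" "\<forall>x\<le>m. f k x = g x" using g(2) by blast
  have "F \<subseteq> {..k}" "\<forall>x\<in>F. f k x = c" using m k F(2) by force+
  then show False using bad F(1) by blast
qed

section \<open>Return times and van der Waerden's theorem\<close>

definition progressions :: "nat \<Rightarrow> nat set set" where
  "progressions K = {(\<lambda>k. a + k * n) ` {..K} | a n. n \<ge> 1}"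

text \<open>
  Return times for \<open>K\<close> give one more term for monochromatic progressions. In a chain of
  monochromatic piecewise syndetic sets \<open>D m\<close>, chosen with \<open>x + k * n\<close> in \<open>D m\<close> for
  \<open>x \<in> D (Suc m)\<close> and \<open>1 \<le> k \<le> Suc K\<close>, the steps \<open>n\<close> add up along the chain. Two sets
  \<open>D i\<close>, \<open>D j\<close> share their colour, and then a point of \<open>D j\<close> has the same colour as its
  translates in \<open>D i\<close>.
\<close>

lemma partition_regular_progressions_Suc:
  assumes P: "\<And>D. piecewise_syndetic D \<Longrightarrow> \<exists>n\<ge>1. piecewise_syndetic {x. \<forall>k\<le>K. x + k * n \<in> D}"
  shows "partition_regular (progressions (Suc K))"
  unfolding partition_regular_def
proof (intro allI impI)
  fix f :: "nat \<Rightarrow> nat"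
  assume fin: "finite (range f)"
  have fin': "finite (f ` D)" for D using fin by (rule finite_subset[rotated]) auto
  have "\<exists>D. \<forall>m. (piecewise_syndetic (D m) \<and> (\<exists>c. \<forall>x\<in>D m. f x = c)) \<and>
          (\<exists>n\<ge>1. \<forall>x\<in>D (Suc m). \<forall>k\<in>{1..Suc K}. x + k * n \<in> D m)"
  proof (rule dependent_nat_choice)
    show "\<exists>D. piecewise_syndetic D \<and> (\<exists>c. \<forall>x\<in>D. f x = c)"
      using piecewise_syndetic_color[OF piecewise_syndetic_pos fin'] by blast
  next
    fix D m
    assume "piecewise_syndetic D \<and> (\<exists>c. \<forall>x\<in>D. f x = c)"
    then obtain n where n: "n \<ge> 1" "piecewise_syndetic {x. \<forall>k\<le>K. x + k * n \<in> D}"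
      using P by blast
    \<comment> \<open>This is the set of return points shifted by \<open>n\<close>, so that \<open>x\<close> itself may have a new colour.\<close>
    let ?E = "{x. \<forall>k\<in>{1..Suc K}. x + k * n \<in> D}"
    from n(2) obtain h where h: "\<And>L. \<exists>s. \<forall>x\<in>{s..<s+L}. \<exists>i\<le>h. \<forall>k\<le>K. x + i + k * n \<in> D"
      unfolding piecewise_syndetic_def by auto
    have "\<exists>s. \<forall>x\<in>{s..<s+L}. \<exists>i\<le>h. x + i \<in> ?E" for L
    proof -
      obtain s where s: "\<forall>x\<in>{s..<s+(L+n)}. \<exists>i\<le>h. \<forall>k\<le>K. x + i + k * n \<in> D" using h by blast
      have "\<exists>i\<le>h. x + i \<in> ?E" if "x \<in> {s..<s+L}" for x
      proof -
        from that s have "\<exists>i\<le>h. \<forall>k\<le>K. x + n + i + k * n \<in> D" by auto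
        then obtain i where i: "i \<le> h" "\<And>k. k \<le> K \<Longrightarrow> x + n + i + k * n \<in> D" by blast
        have "x + i + k * n \<in> D" if "k \<in> {1..Suc K}" for k
          using i(2)[of "k - 1"] that by (cases k) (auto simp: algebra_simps)
        with i(1) show ?thesis by blast
      qed
      then show ?thesis by blast
    qed
    then have "piecewise_syndetic ?E" unfolding piecewise_syndetic_def by blast
    then obtain c where "piecewise_syndetic {x \<in> ?E. f x = c}"
      using piecewise_syndetic_color[OF _ fin'] by blast
    then show "\<exists>D'. (piecewise_syndetic D' \<and> (\<exists>c. \<forall>x\<in>D'. f x = c)) \<and>
        (\<exists>n\<ge>1. \<forall>x\<in>D'. \<forall>k\<in>{1..Suc K}. x + k * n \<in> D)"
      using n(1) by (intro exI[of _ "{x \<in> ?E. f x = c}"]) auto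
  qed
  then obtain D c where D: "\<And>m. piecewise_syndetic (D m)" "\<And>m x. x \<in> D m \<Longrightarrow> f x = c m"
    and step: "\<And>m. \<exists>n\<ge>1. \<forall>x\<in>D (Suc m). \<forall>k\<in>{1..Suc K}. x + k * n \<in> D m" by metis
  have chain: "\<exists>n\<ge>1. \<forall>x\<in>D j. \<forall>k\<in>{1..Suc K}. x + k * n \<in> D i" if "i < j" for i j
    using that
  proof (induction j)
    case (Suc j)
    obtain n where n: "n \<ge> 1" "\<forall>x\<in>D (Suc j). \<forall>k\<in>{1..Suc K}. x + k * n \<in> D j"
      using step by blast
    show ?case
    proof (cases "i = j")
      case True
      then show ?thesis using n by blast
    next
      case False
      then obtain n' where n': "n' \<ge> 1" "\<forall>x\<in>D j. \<forall>k\<in>{1..Suc K}. x + k * n' \<in> D i"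
        using Suc by auto
      have "x + k * (n + n') \<in> D i" if "x \<in> D (Suc j)" "k \<in> {1..Suc K}" for x k
        using n(2) n'(2) that by (simp add: distrib_left add.assoc[symmetric])
      then show ?thesis using n(1) by (intro exI[of _ "n + n'"]) auto
    qed
  qed simp
  have nonempty: "D m \<noteq> {}" for m using D(1) not_piecewise_syndetic_empty by metis
  have "c m \<in> range f" for m using D(2) nonempty by (metis all_not_in_conv rangeI)
  then have "finite (range c)" using fin by (meson finite_subset image_subsetI)
  then have "\<not> inj c" using finite_imageD infinite_UNIV_nat by blast
  then obtain i j where ij: "i < j" "c i = c j" unfolding inj_def by (metis linorder_neqE_nat)
  obtain n where n: "n \<ge> 1" "\<forall>x\<in>D j. \<forall>k\<in>{1..Suc K}. x + k * n \<in> D i" using chain ij(1) by blast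
  obtain x where x: "x \<in> D j" using nonempty by blast
  have "f (x + k * n) = c j" if "k \<le> Suc K" for k
  proof (cases "k = 0")
    case True
    then show ?thesis using D(2)[OF x] by simp
  next
    case False
    then have "x + k * n \<in> D i" using n(2) x that by simp
    then show ?thesis using D(2) ij(2) by simp
  qed
  then have "\<forall>y\<in>(\<lambda>k. x + k * n) ` {..Suc K}. f y = c j" by auto
  then show "\<exists>F\<in>progressions (Suc K). \<exists>c. \<forall>x\<in>F. f x = c"
    using n(1) unfolding progressions_def by blast
qed

text \<open>
  Induction on \<open>K\<close>. Colour each \<open>y\<close> in a window after \<open>x\<close> by the offset \<open>i \<le> h\<close> for which
  \<open>x + y + i\<close> lies in \<open>D\<close>; a progression of constant offset is a progression in \<open>D\<close> close to \<open>x\<close>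
  and with bounded step. Hence the union of the sets of return points over the boundedly many steps
  is piecewise syndetic, and so is one of them.
\<close>

lemma piecewise_syndetic_return:
  assumes "piecewise_syndetic D"
  shows "\<exists>n\<ge>1. piecewise_syndetic {x. \<forall>k\<le>K. x + k * n \<in> D}"
  using assms
proof (induction K arbitrary: D)
  case 0
  then show ?case by auto
next
  case (Suc K)
  obtain h where h: "\<And>L. \<exists>s. \<forall>x\<in>{s..<s+L}. \<exists>i\<le>h. x + i \<in> D"
    using Suc.prems unfolding piecewise_syndetic_def by blast
  \<comment> \<open>A progression of at least two terms in \<open>{..W}\<close> has step at most \<open>W\<close>.\<close>
  have "partition_regular (progressions (Suc K))"
    using partition_regular_progressions_Suc Suc.IH by blast
  moreover have "finite F" if "F \<in> progressions (Suc K)" for F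
    using that unfolding progressions_def by auto
  ultimately obtain W where W: "\<And>f. range f \<subseteq> {..h} \<Longrightarrow>
      \<exists>F\<in>progressions (Suc K). F \<subseteq> {..W} \<and> (\<exists>c. \<forall>x\<in>F. f x = c)"
    using partition_regular_bounded[of "progressions (Suc K)" "{..h}"] by (metis finite_atMost)
  let ?E = "\<lambda>n. {x. \<forall>k\<le>Suc K. x + k * n \<in> D}"
  have "\<exists>s. \<forall>x\<in>{s..<s+L}. \<exists>j\<le>W+h. x + j \<in> (\<Union>n\<in>{1..W}. ?E n)" for L
  proof -
    obtain s where s: "\<forall>x\<in>{s..<s+(L+W)}. \<exists>i\<le>h. x + i \<in> D" using h by blast
    have "\<exists>j\<le>W+h. x + j \<in> (\<Union>n\<in>{1..W}. ?E n)" if x: "x \<in> {s..<s+L}" for x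
    proof -
      have ex: "\<exists>i\<le>h. x + y + i \<in> D" if "y \<le> W" for y using s x that by auto
      define f where "f y = (if y \<le> W then SOME i. i \<le> h \<and> x + y + i \<in> D else 0)" for y
      have f: "f y \<le> h \<and> x + y + f y \<in> D" if "y \<le> W" for y
        using someI_ex[OF ex[OF that]] that unfolding f_def by auto
      have "f y \<le> h" for y using f[of y] by (cases "y \<le> W") (auto simp: f_def)
      then have "range f \<subseteq> {..h}" by auto
      then obtain F c where F: "F \<in> progressions (Suc K)" "F \<subseteq> {..W}" "\<forall>y\<in>F. f y = c"
        using W by blast
      then obtain a n where n: "n \<ge> 1" and Feq: "F = (\<lambda>k. a + k * n) ` {..Suc K}"
        unfolding progressions_def by blast
      have mem: "a + k * n \<le> W \<and> f (a + k * n) = c" if "k \<le> Suc K" for k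
        using F Feq that by auto
      have "n \<le> W" using mem[of 1] by auto
      moreover have "x + (a + c) + k * n \<in> D" if "k \<le> Suc K" for k
        using f[of "a + k * n"] mem[OF that] by (simp add: ac_simps)
      moreover have "a + c \<le> W + h" using mem[of 0] f[of a] by auto
      ultimately have "a + c \<le> W + h \<and> x + (a + c) \<in> (\<Union>n\<in>{1..W}. ?E n)"
        using n by (auto intro!: bexI[of _ n])
      then show ?thesis by blast
    qed
    then show ?thesis by blast
  qed
  then have "piecewise_syndetic (\<Union>n\<in>{1..W}. ?E n)" unfolding piecewise_syndetic_def by blast
  then show ?case using piecewise_syndetic_UN[of "{1..W}" ?E] by auto
qed

section \<open>Sums and products\<close>

text \<open>
  All \<open>G \<in> \<B>\<close> inside \<open>{..N}\<close> are available when the return time \<open>n\<close> is chosen, which is what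
  resolves the conflict that \<open>n\<close> must precede \<open>x\<close> while \<open>G\<close> depends on \<open>x\<close>: for each return point
  \<open>x\<close> some \<open>G\<close> is monochromatic under \<open>b \<mapsto> g (M * n * b * x)\<close>, and sorting the return points by
  the finitely many possible pairs of \<open>G\<close> and its colour leaves a piecewise syndetic class.
\<close>

lemma piecewise_syndetic_refine:
  fixes g :: "nat \<Rightarrow> nat"
  assumes fin: "finite (range g)"
    and N: "\<And>f. range f \<subseteq> range g \<Longrightarrow> \<exists>G\<in>\<B>. G \<subseteq> {..N} \<and> (\<exists>c. \<forall>x\<in>G. f x = c)"
    and D: "piecewise_syndetic D"
  shows "\<exists>n\<ge>1. \<exists>G\<in>\<B>. \<exists>c. \<exists>E. G \<subseteq> {..N} \<and> piecewise_syndetic E \<and> E \<subseteq> D \<and>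
           (\<forall>x\<in>E. \<forall>b\<in>G. g (M * n * b * x) = c) \<and> (\<forall>x\<in>E. \<forall>k\<le>M * N. x + k * n \<in> D)"
proof -
  obtain n where n: "n \<ge> 1" "piecewise_syndetic {x. \<forall>k\<le>M * N. x + k * n \<in> D}"
    using piecewise_syndetic_return[OF D] by blast
  let ?R = "{x. \<forall>k\<le>M * N. x + k * n \<in> D}"
  \<comment> \<open>The colour 0 serves only for an empty \<open>G\<close>.\<close>
  have "\<exists>G c. G \<in> \<B> \<and> G \<subseteq> {..N} \<and> c \<in> insert 0 (range g) \<and> (\<forall>b\<in>G. g (M * n * b * x) = c)" for x
  proof -
    obtain G c where G: "G \<in> \<B>" "G \<subseteq> {..N}" "\<forall>b\<in>G. g (M * n * b * x) = c"
      using N[of "\<lambda>b. g (M * n * b * x)"] by blast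
    show ?thesis
    proof (cases "G = {}")
      case True
      then show ?thesis using G by blast
    next
      case False
      then have "c \<in> range g" using G(3) by (metis all_not_in_conv rangeI)
      then show ?thesis using G by blast
    qed
  qed
  then obtain G c where Gc: "\<And>x. G x \<in> \<B>" "\<And>x. G x \<subseteq> {..N}" "\<And>x. c x \<in> insert 0 (range g)"
    "\<And>x b. b \<in> G x \<Longrightarrow> g (M * n * b * x) = c x" by metis
  have "(\<lambda>x. (G x, c x)) ` ?R \<subseteq> Pow {..N} \<times> insert 0 (range g)" using Gc(2,3) by auto
  then have "finite ((\<lambda>x. (G x, c x)) ` ?R)" by (rule finite_subset) (simp add: fin)
  from piecewise_syndetic_color[OF n(2) this]
  obtain Gc where "piecewise_syndetic {x \<in> ?R. (G x, c x) = Gc}" by blast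
  then obtain G0 c0 where E: "piecewise_syndetic {x \<in> ?R. (G x, c x) = (G0, c0)}"
    by (cases Gc) simp
  let ?E = "{x \<in> ?R. (G x, c x) = (G0, c0)}"
  have "?E \<noteq> {}" using E not_piecewise_syndetic_empty by metis
  then obtain x where "G x = G0" by blast
  then have "G0 \<in> \<B>" "G0 \<subseteq> {..N}" using Gc(1,2) by blast+
  moreover have "?E \<subseteq> D"
  proof
    fix x assume "x \<in> ?E"
    then have "\<forall>k\<le>M * N. x + k * n \<in> D" by blast
    from this[rule_format, of 0] show "x \<in> D" by simp
  qed
  moreover have "\<forall>x\<in>?E. \<forall>b\<in>G0. g (M * n * b * x) = c0" using Gc(4) by blast
  moreover have "\<forall>x\<in>?E. \<forall>k\<le>M * N. x + k * n \<in> D" by blast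
  ultimately show ?thesis using n(1) E by blast
qed

text \<open>
  The combinatorial core, for arbitrary partition regular families of finite sets. Only dilates of
  the sets in \<open>\<A>\<close> and \<open>\<B>\<close> occur, which is why it applies to images of matrices.
\<close>

lemma partition_regular_sum_product:
  fixes f :: "nat \<Rightarrow> nat"
  assumes A: "partition_regular \<A>" "\<And>F. F \<in> \<A> \<Longrightarrow> finite F \<and> 0 \<notin> F"
    and B: "partition_regular \<B>" "\<And>G. G \<in> \<B> \<Longrightarrow> finite G \<and> 0 \<notin> G \<and> G \<noteq> {}"
    and fin: "finite (range f)"
  shows "\<exists>F\<in>\<A>. \<exists>G\<in>\<B>. \<exists>p\<ge>1. \<exists>q\<ge>1. \<exists>c. \<forall>a\<in>F. \<forall>b\<in>G.
           f (p * a) = c \<and> f (p * a + q * b) = c \<and> f (p * a * (q * b)) = c"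
proof -
  have "\<And>F. F \<in> \<A> \<Longrightarrow> finite F" "\<And>G. G \<in> \<B> \<Longrightarrow> finite G" using A(2) B(2) by blast+
  note bounded = partition_regular_bounded[OF A(1) this(1)] partition_regular_bounded[OF B(1) this(2)]
  obtain N where "\<forall>h. range h \<subseteq> range f \<longrightarrow> (\<exists>F\<in>\<A>. F \<subseteq> {..N} \<and> (\<exists>c. \<forall>x\<in>F. h x = c))"
    using bounded(1)[OF _ fin] by blast
  note N = this[rule_format]
  define g where "g x = to_nat (map (\<lambda>m. f (m * x)) [0..<Suc N])" for x
  have g_eq: "f (m * x) = f (m * y)" if "g x = g y" "m \<le> N" for m x y
  proof -
    have "map (\<lambda>m. f (m * x)) [0..<Suc N] = map (\<lambda>m. f (m * y)) [0..<Suc N]"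
      using that(1) unfolding g_def by (rule injD[OF inj_to_nat])
    then have "\<forall>m\<in>set [0..<Suc N]. f (m * x) = f (m * y)" by (simp only: map_eq_conv)
    then show ?thesis using that(2) by auto
  qed
  have "range g \<subseteq> to_nat ` {xs. set xs \<subseteq> range f \<and> length xs = Suc N}"
    unfolding g_def by (auto simp del: upt_Suc intro!: imageI)
  then have ging: "finite (range g)"
    using finite_lists_length_eq[OF fin, of "Suc N"] finite_surj by blast
  obtain N' where "\<forall>h. range h \<subseteq> range g \<longrightarrow> (\<exists>G\<in>\<B>. G \<subseteq> {..N'} \<and> (\<exists>c. \<forall>x\<in>G. h x = c))"
    using bounded(2)[OF _ ging] by blast
  note N' = this[rule_format]
  \<comment> \<open>Multiplying the modulus by the square of \<open>z = M * n * b\<close> makes all later moduli divisible by it.\<close>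
  define step where "step = (\<lambda>D (M::nat) D' M' n G b c.
      n \<ge> (1::nat) \<and> G \<in> \<B> \<and> b \<in> G \<and> G \<subseteq> {..N'} \<and> D' \<subseteq> D \<and> M' = M * (M * n * b)^2 \<and>
      (\<forall>x\<in>D'. \<forall>b\<in>G. g (M * n * b * x) = c) \<and> (\<forall>x\<in>D'. \<forall>k\<le>M * N'. x + k * n \<in> D))"
  have "\<exists>S. \<forall>k. (piecewise_syndetic (fst (S k)) \<and> fst (S k) \<subseteq> {1..} \<and> snd (S k) \<ge> 1 \<and> fact N dvd snd (S k)) \<and>
      (\<exists>n G b c. step (fst (S k)) (snd (S k)) (fst (S (Suc k))) (snd (S (Suc k))) n G b c)"
  proof (rule dependent_nat_choice)
    show "\<exists>S. piecewise_syndetic (fst S) \<and> fst S \<subseteq> {1..} \<and> snd S \<ge> (1::nat) \<and> fact N dvd snd S"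
      by (intro exI[of _ "({1..}, fact N)"]) (use piecewise_syndetic_pos in simp)
  next
    fix S :: "nat set \<times> nat" and k :: nat
    assume S: "piecewise_syndetic (fst S) \<and> fst S \<subseteq> {1..} \<and> snd S \<ge> 1 \<and> fact N dvd snd S"
    let ?D = "fst S" and ?M = "snd S"
    from S have "piecewise_syndetic ?D" by blast
    from piecewise_syndetic_refine[of g \<B> N', OF ging N' this, of ?M]
    obtain n G c E where *: "n \<ge> 1" "G \<in> \<B>" "G \<subseteq> {..N'}" "piecewise_syndetic E" "E \<subseteq> ?D"
      "\<forall>x\<in>E. \<forall>b\<in>G. g (?M * n * b * x) = c" "\<forall>x\<in>E. \<forall>k\<le>?M * N'. x + k * n \<in> ?D" by blast
    obtain b where b: "b \<in> G" using B(2) *(2) by blast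
    have "b \<noteq> 0" using b B(2) *(2) by metis
    then have "?M * (?M * n * b)^2 \<ge> 1" using S *(1) by (simp add: Suc_le_eq)
    moreover have "step ?D ?M E (?M * (?M * n * b)^2) n G b c"
      unfolding step_def using * b by blast
    ultimately show "\<exists>S'. (piecewise_syndetic (fst S') \<and> fst S' \<subseteq> {1..} \<and> snd S' \<ge> 1 \<and> fact N dvd snd S') \<and>
        (\<exists>n G b c. step ?D ?M (fst S') (snd S') n G b c)"
      using S *(4,5) by (intro exI[of _ "(E, ?M * (?M * n * b)^2)"]) auto
  qed
  then obtain S n G b c where S: "\<And>k. piecewise_syndetic (fst (S k)) \<and> fst (S k) \<subseteq> {1..} \<and> snd (S k) \<ge> 1 \<and> fact N dvd snd (S k)"
    and st: "\<And>k. step (fst (S k)) (snd (S k)) (fst (S (Suc k))) (snd (S (Suc k))) (n k) (G k) (b k) (c k)"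
    by metis
  define D where "D k = fst (S k)" for k
  define M where "M k = snd (S k)" for k
  define z where "z k = M k * n k * b k" for k
  have ps: "piecewise_syndetic (D k)" and Dpos: "D k \<subseteq> {1..}" and Mpos: "M k \<ge> 1"
    and factM: "fact N dvd M k" for k
    using S[of k] unfolding D_def M_def by blast+
  have n: "n k \<ge> 1" and G: "G k \<in> \<B>" "G k \<subseteq> {..N'}" and b: "b k \<in> G k"
    and Dsub: "D (Suc k) \<subseteq> D k" and MSuc: "M (Suc k) = M k * (z k)^2"
    and col: "\<And>x b. x \<in> D (Suc k) \<Longrightarrow> b \<in> G k \<Longrightarrow> g (M k * n k * b * x) = c k"
    and ret: "\<And>x m. x \<in> D (Suc k) \<Longrightarrow> m \<le> M k * N' \<Longrightarrow> x + m * n k \<in> D k" for k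
    using st[of k] unfolding step_def D_def M_def z_def by blast+
  have zcol: "g (z k * x) = c k" if "x \<in> D (Suc k)" for k x
    using col[OF that b] unfolding z_def .
  have anti: "D j \<subseteq> D i" if "i \<le> j" for i j
    using lift_Suc_antimono_le[of D, OF Dsub that] .
  have Mdvd: "M i dvd M j" if "i \<le> j" for i j
    using that by (induction j rule: dec_induct) (auto simp: MSuc)
  have zpos: "z k \<ge> 1" for k
    using B(2)[OF G(1)[of k]] b[of k] Mpos[of k] n[of k]
    unfolding z_def by (metis One_nat_def Suc_leI gr0I mult_is_0 not_one_le_zero)
  have "c k \<in> range g" for k
    using zcol ps[of "Suc k"] not_piecewise_syndetic_empty by (metis all_not_in_conv rangeI)
  then have "finite (range c)" using ging by (meson finite_subset image_subsetI)
  then have "\<not> inj c" using finite_imageD infinite_UNIV_nat by blast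
  then obtain i j where ij: "i < j" "c i = c j" unfolding inj_def by (metis linorder_neqE_nat)
  obtain x where x: "x \<in> D (Suc j)" using ps not_piecewise_syndetic_empty by (metis all_not_in_conv)
  have xpos: "x \<ge> 1" using x Dpos by auto
  have xi: "x \<in> D (Suc i)" using x anti[of "Suc i" "Suc j"] ij by auto
  \<comment> \<open>The image of \<open>A\<close> is chosen last, for the multiples of the single number \<open>z i * x\<close>.\<close>
  obtain F d where F: "F \<in> \<A>" "F \<subseteq> {..N}" "\<forall>m\<in>F. f (m * (z i * x)) = d"
    using N[of "\<lambda>m. f (m * (z i * x))"] by blast
  have "fact N * (z i)^2 dvd M (Suc i)" unfolding MSuc by (intro mult_dvd_mono factM dvd_refl)
  then have key: "fact N * (z i)^2 dvd M j" using Mdvd[of "Suc i" j] ij by (auto intro: dvd_trans)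
  have "z i dvd M j" by (rule dvd_trans[OF _ key]) (simp add: power2_eq_square)
  then obtain w where w: "M j = z i * w" by blast
  have "w * n j \<ge> 1" using w Mpos[of j] n[of j] by (cases w) auto
  moreover have "z i * x \<ge> 1" using zpos[of i] xpos by (simp add: Suc_le_eq)
  moreover have "f (z i * x * m) = d \<and> f (z i * x * m + w * n j * e) = d \<and>
      f (z i * x * m * (w * n j * e)) = d" if m: "m \<in> F" and e: "e \<in> G j" for m e
  proof (intro conjI)
    have mN: "m \<le> N" "m \<ge> 1" using F(1,2) m A(2) by (auto simp: Suc_le_eq intro!: gr0I)
    show 1: "f (z i * x * m) = d" using F(3) m by (simp add: ac_simps)
    have "g (M j * n j * e * x) = g (z i * x)" using col[OF x e] zcol[OF xi] ij by simp
    from g_eq[OF this mN(1)] have "f (m * (M j * n j * e * x)) = d" using F(3) m by simp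
    moreover have "z i * x * m * (w * n j * e) = m * (M j * n j * e * x)" unfolding w by simp
    ultimately show "f (z i * x * m * (w * n j * e)) = d" by (simp only:)
    have "m dvd fact N" using mN by (simp add: dvd_fact)
    then have "m * (z i)^2 dvd M j" using dvd_trans[OF mult_dvd_mono[OF _ dvd_refl] key] by blast
    then obtain r where r: "M j = m * (z i)^2 * r" by blast
    have "z i * w = z i * (m * z i * r)"
      unfolding w[symmetric] r by (simp only: power2_eq_square ac_simps)
    then have wr: "w = m * z i * r" using zpos[of i] by auto
    have "M j > 0" using Mpos[of j] by simp
    then have "r \<le> M j" by (rule dvd_imp_le[rotated]) (simp add: r)
    moreover have "e \<le> N'" using G(2)[of j] e by auto
    ultimately have "r * e \<le> M j * N'" by (rule mult_le_mono)
    then have "x + r * e * n j \<in> D j" using ret[OF x] by blast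
    then have "x + r * e * n j \<in> D (Suc i)" using anti[of "Suc i" j] ij by auto
    from zcol[OF this] have "g (z i * (x + r * e * n j)) = g (z i * x)" using zcol[OF xi] by simp
    from g_eq[OF this mN(1)] have "f (m * (z i * (x + r * e * n j))) = d" using F(3) m by simp
    moreover have "z i * x * m + w * n j * e = m * (z i * (x + r * e * n j))"
      unfolding wr by (simp add: algebra_simps)
    ultimately show "f (z i * x * m + w * n j * e) = d" by (simp only:)
  qed
  ultimately show ?thesis
    by (intro bexI[OF _ F(1)] bexI[OF _ G(1)[of j]] exI[of _ "z i * x"] exI[of _ "w * n j"]
        exI[of _ d] conjI ballI) simp_all
qed

section \<open>Images of matrices\<close>

definition image_sets :: "rat mat \<Rightarrow> nat set set" where
  "image_sets A = {F. F \<subseteq> {1..} \<and> (\<exists>X\<in>pos_vec (dim_col A). image_entries A X = of_nat ` F)}"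

lemma partition_regular_image_sets:
  assumes "image_partition_regular A"
  shows "partition_regular (image_sets A)"
  unfolding partition_regular_def
proof (intro allI impI)
  fix f :: "nat \<Rightarrow> nat"
  assume fin: "finite (range f)"
  define P where "P = (\<lambda>c. {x \<in> {1..}. f x = c}) ` range f - {{}}"
  have "partition_on {1..} P"
    unfolding P_def by (rule partition_onI) (auto simp: disjnt_def)
  moreover have "finite P" unfolding P_def using fin by simp
  ultimately obtain X C where X: "X \<in> pos_vec (dim_col A)" "C \<in> P" "image_entries A X \<subseteq> of_nat ` C"
    using assms unfolding image_partition_regular_def finite_coloring_def monochromatic_def by blast
  from X(3) obtain F where F: "F \<subseteq> C" "image_entries A X = of_nat ` F"
    by (meson subset_image_iff)
  from X(2) obtain c where "C = {x \<in> {1..}. f x = c}" unfolding P_def by blast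
  then have "F \<in> image_sets A" "\<forall>x\<in>F. f x = c" unfolding image_sets_def using F X(1) by auto
  then show "\<exists>F\<in>image_sets A. \<exists>c. \<forall>x\<in>F. f x = c" by blast
qed

lemma image_sets_finite:
  assumes "F \<in> image_sets A"
  shows "finite F \<and> 0 \<notin> F"
proof -
  obtain X where X: "F \<subseteq> {1..}" "image_entries A X = of_nat ` F"
    using assms unfolding image_sets_def by blast
  have "finite (image_entries A X)" unfolding image_entries_def vec_set_def by simp
  then have "finite F" unfolding X(2) by (rule finite_imageD) (simp add: inj_on_def)
  then show ?thesis using X(1) by auto
qed

lemma image_sets_nonempty:
  assumes "F \<in> image_sets A" "dim_row A \<ge> 1"
  shows "F \<noteq> {}"
proof -
  obtain X where X: "image_entries A X = of_nat ` F"
    using assms unfolding image_sets_def by blast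
  have "image_entries A X \<noteq> {}"
    unfolding image_entries_def vec_set_def using assms(2) by (auto simp: lessThan_empty_iff)
  then show ?thesis using X by auto
qed

lemma image_entries_smult:
  assumes "X \<in> carrier_vec (dim_col A)"
  shows "image_entries A (p \<cdot>\<^sub>v X) = (\<lambda>a. of_nat p * a) ` image_entries A X"
proof -
  have "map_vec of_nat (p \<cdot>\<^sub>v X) = (of_nat p :: rat) \<cdot>\<^sub>v map_vec of_nat X"
    by (rule eq_vecI) auto
  then have "A *\<^sub>v map_vec of_nat (p \<cdot>\<^sub>v X) = of_nat p \<cdot>\<^sub>v (A *\<^sub>v map_vec of_nat X)"
    using mult_mat_vec[of A "dim_row A" "dim_col A" "map_vec of_nat X" "of_nat p"] assms by simp
  then show ?thesis unfolding image_entries_def vec_set_def by force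
qed

lemma image_sets_dilate:
  assumes "F \<in> image_sets A" "p \<ge> 1"
  obtains X where "X \<in> pos_vec (dim_col A)" "image_entries A X = (\<lambda>a. of_nat (p * a)) ` F"
proof -
  obtain X where X: "X \<in> pos_vec (dim_col A)" "image_entries A X = of_nat ` F"
    using assms unfolding image_sets_def by blast
  have "p \<cdot>\<^sub>v X \<in> pos_vec (dim_col A)" using X(1) assms(2) unfolding pos_vec_def by auto
  moreover have "image_entries A (p \<cdot>\<^sub>v X) = (\<lambda>a. of_nat (p * a)) ` F"
    using image_entries_smult[of X A p] X unfolding pos_vec_def by (simp add: image_image)
  ultimately show thesis using that by blast
qed

text \<open>
  The value at 0, which belongs to no piece, is that of 1, so that it contributes no new colour.
\<close>

lemma finite_coloring_function:
  assumes "finite_coloring P"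
  obtains f :: "nat \<Rightarrow> nat" where "finite (range f)"
    "\<And>c. \<exists>C\<in>P. {x. x \<ge> 1 \<and> f x = c} \<subseteq> C"
proof -
  have part: "partition_on {1..} P" and fin: "finite P"
    using assms unfolding finite_coloring_def by auto
  obtain idx :: "nat set \<Rightarrow> nat" where idx: "inj_on idx P"
    using finite_imp_inj_to_nat_seg[OF fin] by blast
  have un: "\<Union>P = {1..}" using partition_onD1[OF part] by simp
  then have "\<forall>x\<in>{1..}. \<exists>C\<in>P. x \<in> C" by blast
  then obtain blk where blk: "\<And>x. x \<ge> 1 \<Longrightarrow> blk x \<in> P \<and> x \<in> blk x" by (metis atLeast_iff)
  define f where "f x = (if x \<ge> 1 then idx (blk x) else idx (blk 1))" for x :: nat
  have "range f \<subseteq> idx ` P" unfolding f_def using blk by auto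
  then have "finite (range f)" using fin finite_surj by blast
  moreover have "\<exists>C\<in>P. {x. x \<ge> 1 \<and> f x = c} \<subseteq> C" for c
  proof (cases "\<exists>y\<ge>1. f y = c")
    case True
    then obtain y where y: "y \<ge> 1" "f y = c" by blast
    have "x \<in> blk y" if "x \<ge> 1" "f x = c" for x
      using that y blk idx unfolding f_def inj_on_def by metis
    then show ?thesis using blk y by blast
  next
    case False
    then show ?thesis using blk[of 1] by blast
  qed
  ultimately show thesis using that by blast
qed

theorem mainTheorem2:
  fixes u v :: nat and A B :: "rat mat" and P :: "nat set set"
  assumes "u \<ge> 1" and "v \<ge> 1"
    and "A \<in> carrier_mat u v" and "B \<in> carrier_mat u v"
    and "image_partition_regular A" and "image_partition_regular B"
    and "finite_coloring P"
  shows "\<exists>X\<in>pos_vec v. \<exists>Y\<in>pos_vec v.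
           monochromatic P
             (\<Union>a\<in>image_entries A X. \<Union>b\<in>image_entries B Y. {a, a + b, a * b})"
proof -
  have dims: "dim_col A = v" "dim_col B = v" "dim_row B \<ge> 1" using assms(1,3,4) by auto
  obtain f :: "nat \<Rightarrow> nat" where f: "finite (range f)" "\<And>c. \<exists>C\<in>P. {x. x \<ge> 1 \<and> f x = c} \<subseteq> C"
    using finite_coloring_function[OF assms(7)] by blast
  have "\<exists>F\<in>image_sets A. \<exists>G\<in>image_sets B. \<exists>p\<ge>1. \<exists>q\<ge>1. \<exists>c. \<forall>a\<in>F. \<forall>b\<in>G.
           f (p * a) = c \<and> f (p * a + q * b) = c \<and> f (p * a * (q * b)) = c"
  proof (rule partition_regular_sum_product[OF _ _ _ _ f(1)])
    show "partition_regular (image_sets A)" "partition_regular (image_sets B)"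
      by (rule partition_regular_image_sets, fact)+
    show "finite F \<and> 0 \<notin> F" if "F \<in> image_sets A" for F using that by (rule image_sets_finite)
    show "finite G \<and> 0 \<notin> G \<and> G \<noteq> {}" if "G \<in> image_sets B" for G
      using image_sets_finite[OF that] image_sets_nonempty[OF that dims(3)] by simp
  qed
  then obtain F G p q c where F: "F \<in> image_sets A" and G: "G \<in> image_sets B"
    and p: "p \<ge> 1" and q: "q \<ge> 1"
    and mono: "\<And>a b. a \<in> F \<Longrightarrow> b \<in> G \<Longrightarrow>
      f (p * a) = c \<and> f (p * a + q * b) = c \<and> f (p * a * (q * b)) = c" by blast
  obtain X where X: "X \<in> pos_vec v" "image_entries A X = (\<lambda>a. of_nat (p * a)) ` F"
    using image_sets_dilate[OF F p] dims by metis
  obtain Y where Y: "Y \<in> pos_vec v" "image_entries B Y = (\<lambda>b. of_nat (q * b)) ` G"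
    using image_sets_dilate[OF G q] dims by metis
  obtain C where C: "C \<in> P" "{x. x \<ge> 1 \<and> f x = c} \<subseteq> C" using f(2) by blast
  have "{of_nat (p * a), of_nat (p * a) + of_nat (q * b), of_nat (p * a) * of_nat (q * b)}
      \<subseteq> (of_nat ` C :: rat set)" if ab: "a \<in> F" "b \<in> G" for a b
  proof -
    have "a \<noteq> 0" "b \<noteq> 0" using image_sets_finite F G ab by metis+
    then have pos: "p * a \<ge> 1" "p * a + q * b \<ge> 1" "p * a * (q * b) \<ge> 1"
      using p q by (auto simp: Suc_le_eq)
    have "p * a \<in> C" "p * a + q * b \<in> C" "p * a * (q * b) \<in> C"
      using C(2) mono[OF ab] pos by blast+
    then show ?thesis
      unfolding of_nat_add[symmetric] of_nat_mult[symmetric] by blast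
  qed
  then have "(\<Union>a\<in>image_entries A X. \<Union>b\<in>image_entries B Y. {a, a + b, a * b}) \<subseteq> of_nat ` C"
    unfolding X(2) Y(2) by blast
  then have "monochromatic P (\<Union>a\<in>image_entries A X. \<Union>b\<in>image_entries B Y. {a, a + b, a * b})"
    unfolding monochromatic_def using C(1) by blast
  then show ?thesis using X(1) Y(1) by blast
qed

end
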